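(* Let $G$ be a group with identity $e$, $U$ a set, and $f_G$ a normal soft int-group in $G$ over $U$. Then the groups $G/f_G$ and $G/e_{f_G}$ are isomorphic: $G/f_G\cong G/e_{f_G}$.
   Context: Let $P(U)$ be the power set of $U$. A soft int-group in $G$ over $U$ is a function $f_G:G\to P(U)$ such that $f_G(xy)\supseteq f_G(x)\cap f_G(y)$ and $f_G(x^{-1})=f_G(x)$ for all $x,y\in G$; it is a normal soft int-group if moreover $f_G(xy)=f_G(yx)$ for all $x,y\in G$. The $e$-set of $f_G$ is $e_{f_G}=\{x\in G: f_G(x)=f_G(e)\}$, which is a normal subgroup of $G$ when $f_G$ is a normal soft int-group. For $a\in G$, the soft coset $af_G:G\to P(U)$ is defined by $(af_G)(x)=f_G(a^{-1}x)$. The soft product of functions $f,g:G\to P(U)$ is $(f\ast g)(x)=\bigcup\{f(u)\cap g(v): u,v\in G,\ uv=x\}$. The quotient group of $G$ relative to $f_G$ is the set $G/f_G=\{xf_G:x\in G\}$ with operation $\ast$, which is a group satisfying $(xf_G)\ast(yf_G)=(xy)f_G$. *)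

theory Defs
  imports "HOL-Algebra.Coset"
begin

definition soft_int_group :: "('a, 'm) monoid_scheme \<Rightarrow> 'u set \<Rightarrow> ('a \<Rightarrow> 'u set) \<Rightarrow> bool" where
  "soft_int_group G U f \<longleftrightarrow>
     f \<in> carrier G \<rightarrow> Pow U \<and>
     (\<forall>x\<in>carrier G. \<forall>y\<in>carrier G. f x \<inter> f y \<subseteq> f (x \<otimes>\<^bsub>G\<^esub> y)) \<and>
     (\<forall>x\<in>carrier G. f (inv\<^bsub>G\<^esub> x) = f x)"

definition normal_soft_int_group :: "('a, 'm) monoid_scheme \<Rightarrow> 'u set \<Rightarrow> ('a \<Rightarrow> 'u set) \<Rightarrow> bool" where
  "normal_soft_int_group G U f \<longleftrightarrow>
     soft_int_group G U f \<and>
     (\<forall>x\<in>carrier G. \<forall>y\<in>carrier G. f (x \<otimes>\<^bsub>G\<^esub> y) = f (y \<otimes>\<^bsub>G\<^esub> x))"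

definition e_set :: "('a, 'm) monoid_scheme \<Rightarrow> ('a \<Rightarrow> 'u set) \<Rightarrow> 'a set" where
  "e_set G f = {x \<in> carrier G. f x = f \<one>\<^bsub>G\<^esub>}"

text \<open>Soft cosets and soft products are functions on the carrier. They are restricted to it, so that
  HOL equality of two of them is equality as functions on the group, whatever values \<open>f\<close> takes
  outside the carrier.\<close>

definition soft_coset :: "('a, 'm) monoid_scheme \<Rightarrow> 'a \<Rightarrow> ('a \<Rightarrow> 'u set) \<Rightarrow> 'a \<Rightarrow> 'u set" where
  "soft_coset G a f = (\<lambda>x\<in>carrier G. f (inv\<^bsub>G\<^esub> a \<otimes>\<^bsub>G\<^esub> x))"

definition soft_product ::
    "('a, 'm) monoid_scheme \<Rightarrow> ('a \<Rightarrow> 'u set) \<Rightarrow> ('a \<Rightarrow> 'u set) \<Rightarrow> 'a \<Rightarrow> 'u set" where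
  "soft_product G f g =
     (\<lambda>x\<in>carrier G. \<Union>{f u \<inter> g v | u v. u \<in> carrier G \<and> v \<in> carrier G \<and> u \<otimes>\<^bsub>G\<^esub> v = x})"

definition soft_quotient :: "('a, 'm) monoid_scheme \<Rightarrow> ('a \<Rightarrow> 'u set) \<Rightarrow> ('a \<Rightarrow> 'u set) monoid" where
  "soft_quotient G f =
     \<lparr>carrier = (\<lambda>x. soft_coset G x f) ` carrier G,
      monoid.mult = soft_product G,
      one = soft_coset G \<one>\<^bsub>G\<^esub> f\<rparr>"

text \<open>\<open>soft_quotient G f\<close> and \<open>G Mod e_set G f\<close> are groups: the coset product law makes
  the former one, and the \<open>e\<close>-set is normal.\<close>

context
  fixes G :: "('a, 'm) monoid_scheme" (structure)
    and U :: "'u set" and f :: "'a \<Rightarrow> 'u set"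
  assumes grp: "group G" and nsg: "normal_soft_int_group G U f"
begin

interpretation group G by (rule grp)

lemma soft_mult: "x \<in> carrier G \<Longrightarrow> y \<in> carrier G \<Longrightarrow> f x \<inter> f y \<subseteq> f (x \<otimes> y)"
  and soft_inv: "x \<in> carrier G \<Longrightarrow> f (inv x) = f x"
  and soft_comm: "x \<in> carrier G \<Longrightarrow> y \<in> carrier G \<Longrightarrow> f (x \<otimes> y) = f (y \<otimes> x)"
  using nsg unfolding normal_soft_int_group_def soft_int_group_def by blast+

lemma soft_le_one: "x \<in> carrier G \<Longrightarrow> f x \<subseteq> f \<one>"
  using soft_mult[of x "inv x"] by (simp add: soft_inv)

lemma soft_product_coset:
  assumes a: "a \<in> carrier G" and b: "b \<in> carrier G"
  shows "soft_product G (soft_coset G a f) (soft_coset G b f) = soft_coset G (a \<otimes> b) f"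
proof
  fix x
  show "soft_product G (soft_coset G a f) (soft_coset G b f) x = soft_coset G (a \<otimes> b) f x"
  proof (cases "x \<in> carrier G")
    case False
    then show ?thesis by (simp add: soft_product_def soft_coset_def)
  next
    case x: True
    let ?S = "\<Union>{f (inv a \<otimes> u) \<inter> f (inv b \<otimes> v) | u v.
                  u \<in> carrier G \<and> v \<in> carrier G \<and> u \<otimes> v = x}"
    have "f (inv a \<otimes> u) \<inter> f (inv b \<otimes> v) \<subseteq> f (inv (a \<otimes> b) \<otimes> x)"
      if u: "u \<in> carrier G" and v: "v \<in> carrier G" and uv: "u \<otimes> v = x" for u v
    proof -
      have "f (inv a \<otimes> u) \<inter> f (inv b \<otimes> v) = f (inv a \<otimes> u) \<inter> f (v \<otimes> inv b)"
        using soft_comm[of "inv b" v] b v by simp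
      also have "\<dots> \<subseteq> f ((inv a \<otimes> u) \<otimes> (v \<otimes> inv b))"
        using a b u v by (intro soft_mult) auto
      also have "(inv a \<otimes> u) \<otimes> (v \<otimes> inv b) = (inv a \<otimes> x) \<otimes> inv b"
        using a b u v uv by (simp add: m_assoc flip: uv)
      also have "f \<dots> = f (inv b \<otimes> (inv a \<otimes> x))"
        using a b x by (intro soft_comm) auto
      also have "inv b \<otimes> (inv a \<otimes> x) = inv (a \<otimes> b) \<otimes> x"
        using a b x by (simp add: inv_mult_group m_assoc)
      finally show ?thesis .
    qed
    then have "?S \<subseteq> f (inv (a \<otimes> b) \<otimes> x)" by blast
    moreover have "f (inv (a \<otimes> b) \<otimes> x) \<subseteq> ?S"
    proof -
      have "f (inv (a \<otimes> b) \<otimes> x) \<subseteq> f (inv a \<otimes> a) \<inter> f (inv b \<otimes> (inv a \<otimes> x))"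
        using a b x soft_le_one[of "inv (a \<otimes> b) \<otimes> x"] by (simp add: inv_mult_group m_assoc)
      moreover have "a \<otimes> (inv a \<otimes> x) = x"
        using a x by (simp flip: m_assoc)
      moreover have "inv a \<otimes> x \<in> carrier G" using a x by simp
      ultimately show ?thesis using a by blast
    qed
    moreover have "soft_product G (soft_coset G a f) (soft_coset G b f) x = ?S"
      using x unfolding soft_product_def soft_coset_def
      by (simp, intro arg_cong[where f=Union]) (metis (no_types, lifting) restrict_apply')
    ultimately show ?thesis using x by (simp add: soft_coset_def)
  qed
qed

lemma group_soft_quotient: "group (soft_quotient G f)"
proof (rule groupI)
  fix x assume "x \<in> carrier (soft_quotient G f)"
  then obtain a where a: "a \<in> carrier G" "x = soft_coset G a f"
    by (auto simp: soft_quotient_def)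
  show "\<exists>y\<in>carrier (soft_quotient G f). y \<otimes>\<^bsub>soft_quotient G f\<^esub> x = \<one>\<^bsub>soft_quotient G f\<^esub>"
    using a by (intro bexI[of _ "soft_coset G (inv a) f"])
               (auto simp: soft_quotient_def soft_product_coset)
qed (auto simp: soft_quotient_def soft_product_coset m_assoc)

lemma normal_e_set: "e_set G f \<lhd> G"
proof (rule normal_invI)
  show "subgroup (e_set G f) G"
  proof (rule subgroupI)
    fix a b assume "a \<in> e_set G f" "b \<in> e_set G f"
    then show "a \<otimes> b \<in> e_set G f"
      using soft_mult[of a b] soft_le_one[of "a \<otimes> b"] by (auto simp: e_set_def)
  qed (auto simp: e_set_def soft_inv)
next
  fix x h assume x: "x \<in> carrier G" and "h \<in> e_set G f"
  then have h: "h \<in> carrier G" "f h = f \<one>" by (auto simp: e_set_def)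
  have "f (x \<otimes> h \<otimes> inv x) = f (inv x \<otimes> (x \<otimes> h))"
    using x h by (intro soft_comm) auto
  also have "inv x \<otimes> (x \<otimes> h) = h" using x h by (simp flip: m_assoc)
  finally show "x \<otimes> h \<otimes> inv x \<in> e_set G f" using x h by (simp add: e_set_def)
qed

end

end

(* The map a |-> aF is a homomorphism from G onto the soft quotient, and its kernel is the e-set:
   aF = eF gives f(a) = f(e) on evaluating at a, while f(a) = f(e) is the largest value of f,
   so translating by a or by its inverse can only enlarge f. *)
theory Submission
  imports Defs
begin

lemma soft_coset_eq_one_iff:
  assumes "group G" and nsg: "normal_soft_int_group G U f" and a: "a \<in> carrier G"
  shows "soft_coset G a f = soft_coset G \<one>\<^bsub>G\<^esub> f \<longleftrightarrow> f a = f \<one>\<^bsub>G\<^esub>"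
proof
  interpret group G by fact
  assume "soft_coset G a f = soft_coset G \<one>\<^bsub>G\<^esub> f"
  then have "soft_coset G a f a = soft_coset G \<one>\<^bsub>G\<^esub> f a" by simp
  \<comment> \<open>At \<open>a\<close> the left-hand coset takes the value \<open>f \<one>\<close>
    and the right-hand one \<open>f a\<close>.\<close>
  then show "f a = f \<one>\<^bsub>G\<^esub>" using a by (simp add: soft_coset_def)
next
  interpret group G by fact
  note mult = soft_mult[OF \<open>group G\<close> nsg] and le_one = soft_le_one[OF \<open>group G\<close> nsg]
  assume fa: "f a = f \<one>\<^bsub>G\<^esub>"
  have "f (inv\<^bsub>G\<^esub> a \<otimes>\<^bsub>G\<^esub> x) = f x" if x: "x \<in> carrier G" for x
  proof
    have "a \<otimes>\<^bsub>G\<^esub> (inv\<^bsub>G\<^esub> a \<otimes>\<^bsub>G\<^esub> x) = x"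
      using a x by (simp flip: m_assoc)
    \<comment> \<open>Since \<open>f a\<close> is the largest value, intersecting with it changes
      nothing; \<open>mult\<close> at \<open>a\<close> and \<open>inv a \<otimes> x\<close> then
      yields the inclusion.\<close>
    then show "f (inv\<^bsub>G\<^esub> a \<otimes>\<^bsub>G\<^esub> x) \<subseteq> f x"
      using mult[of a "inv\<^bsub>G\<^esub> a \<otimes>\<^bsub>G\<^esub> x"] le_one[of "inv\<^bsub>G\<^esub> a \<otimes>\<^bsub>G\<^esub> x"] fa a x by auto
    \<comment> \<open>Invariance under inversion makes \<open>f (inv a)\<close> the largest value
      too.\<close>
    show "f x \<subseteq> f (inv\<^bsub>G\<^esub> a \<otimes>\<^bsub>G\<^esub> x)"
      using mult[of "inv\<^bsub>G\<^esub> a" x] le_one[of x] soft_inv[OF \<open>group G\<close> nsg a] fa a x by auto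
  qed
  \<comment> \<open>Both cosets are \<open>undefined\<close> off the carrier, so agreement on it
    suffices.\<close>
  then show "soft_coset G a f = soft_coset G \<one>\<^bsub>G\<^esub> f"
    by (auto simp: soft_coset_def intro!: restrict_ext)
qed

theorem theorem3p38:
  fixes G :: "('a, 'm) monoid_scheme" and U :: "'u set" and f :: "'a \<Rightarrow> 'u set"
  assumes "group G" and "normal_soft_int_group G U f"
  shows "soft_quotient G f \<cong> G Mod e_set G f"
proof -
  let ?h = "\<lambda>a. soft_coset G a f"
  have ker: "kernel G (soft_quotient G f) ?h = e_set G f"
    using soft_coset_eq_one_iff[OF assms]
    by (auto simp: kernel_def e_set_def soft_quotient_def)
  have "?h \<in> hom G (soft_quotient G f)"
    by (rule homI) (auto simp: soft_quotient_def soft_product_coset[OF assms])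
  then interpret group_hom G "soft_quotient G f" ?h
    using assms group_soft_quotient[OF assms] by (simp add: group_hom_def group_hom_axioms_def)
  \<comment> \<open>First isomorphism theorem; surjectivity is built into the carrier of
    \<open>soft_quotient\<close>, an image. With the unit unfolded, \<open>hom_one\<close> would
    rewrite in a circle.\<close>
  have "G Mod e_set G f \<cong> soft_quotient G f"
    using FactGroup_iso unfolding ker by (simp add: soft_quotient_def del: hom_one)
  \<comment> \<open>Reversing the isomorphism requires its source to be a group, hence the normality
    of the \<open>e\<close>-set.\<close>
  then show ?thesis
    by (rule group.iso_sym[OF normal.factorgroup_is_group[OF normal_e_set[OF assms]]])
qed

end
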